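(* Let $\mathcal{G}(s,p)$ be the Grundy number of position $\{s,p\}$ in one-pile restricted Nim with a pass (rule sequence $f(x)=\lceil x/2\rceil$). Then: (i) $\mathcal{G}(0,0)=0$ and $\mathcal{G}(0,1)=0$. (ii) For $u\in N$, if $\mathcal{G}(u,0)=0$, then $\mathcal{G}(u,1)=1$. (iii) For $u\in N$, if $\mathcal{G}(u,0)=2$, then $\mathcal{G}(u,1)=0$. (iv) For $u,m\in N$ such that $m>1$, if $\mathcal{G}(u,0)=2m$, then $\mathcal{G}(u,1)=2m-1$. (v) For $u,m\in N$, if $\mathcal{G}(u,0)=2m-1$, then $\mathcal{G}(u,1)=2m$.
   Context: $Z_{\ge 0}$ is the set of non-negative integers and $N$ is the set of positive integers. For a set $S$ of non-negative integers, $\mathrm{mex}(S)$ is the smallest non-negative integer not in $S$. The Grundy number of a position $\mathbf{p}$ of an impartial game is defined recursively by $\mathcal{G}(\mathbf{p})=\mathrm{mex}(\{\mathcal{G}(\mathbf{h}):\mathbf{h}\in \mathrm{move}(\mathbf{p})\})$, where $\mathrm{move}(\mathbf{p})$ is the set of positions reachable from $\mathbf{p}$ in exactly one move. One-pile restricted Nim with a pass: positions are ordered pairs $\{t,p\}$ with $t\in Z_{\ge 0}$ (number of stones) and $p\in\{0,1\}$ ($p=1$ if the pass is still available, $p=0$ otherwise). If $p=1$ and $t>0$, then $\mathrm{move}(t,p)=\{\{t-v,p\}: v\in N,\ v\le\lceil t/2\rceil\}\cup\{\{t,0\}\}$. If $p=0$ or $t=0$, then $\mathrm{move}(t,p)=\{\{t-v,p\}: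 v\in N,\ v\le\lceil t/2\rceil\}$. In particular the pass is not available from the terminal position $\{0,1\}$. *)

theory Defs
  imports Complex_Main
begin

definition mex :: "nat set \<Rightarrow> nat" where
  "mex S = (LEAST n. n \<notin> S)"

text \<open>
  A position is a pair \<open>(t, p)\<close> of a number of stones \<open>t\<close> and a pass indicator \<open>p\<close>,
  where \<open>p = 1\<close> if the pass is still available and \<open>p = 0\<close> otherwise.
  The subtraction on \<^typ>\<open>nat\<close> never truncates, because \<open>\<lceil>t / 2\<rceil> \<le> t\<close>.
\<close>

definition stone_moves :: "nat \<times> nat \<Rightarrow> (nat \<times> nat) set" where
  "stone_moves = (\<lambda>(t, p). {(t - v, p) | v. v > 0 \<and> int v \<le> \<lceil>real t / 2\<rceil>})"

definition moves :: "nat \<times> nat \<Rightarrow> (nat \<times> nat) set" where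
  "moves = (\<lambda>(t, p). if p = 1 \<and> t > 0 then stone_moves (t, p) \<union> {(t, 0)}
                     else stone_moves (t, p))"

lemma moves_decrease:
  assumes "h \<in> moves q"
  shows "fst h + snd h < fst q + snd q"
proof -
  have "t - v < t" if "v > 0" "int v \<le> \<lceil>real t / 2\<rceil>" for t v :: nat
    using that by (cases "t = 0") auto
  with assms show ?thesis
    by (cases q) (auto simp: moves_def stone_moves_def split: if_splits)
qed

function grundy :: "nat \<times> nat \<Rightarrow> nat" where
  "grundy q = mex (grundy ` moves q)"
  by auto
termination
  by (relation "measure (\<lambda>q. fst q + snd q)") (auto dest: moves_decrease)

declare grundy.simps [simp del]

end

theory Submission
  imports Defs
begin

text \<open>
  From \<open>t\<close> stones one reaches exactly the sizes in the window from \<open>t div 2\<close> to \<open>t - 1\<close>.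
  Without a pass, the Grundy numbers on the window from \<open>k\<close> to \<open>2k\<close> are \<open>0, \<dots>, k\<close>, each
  attained once; hence \<open>2k + 1\<close> gets the new value \<open>k + 1\<close>, while \<open>2k + 2\<close> gets the value of
  the position \<open>k\<close> that has just left the window. With a pass, the Grundy number of a nonempty
  pile is the image of the one without under a fixed-point free injection \<open>\<phi> = pass_value\<close>: if \<open>A\<close> is the set
  of values on the window and \<open>c = mex A\<close>, then \<open>mex (\<phi> ` A \<union> {c}) = \<phi> c\<close>. This needs only that
  every \<open>j < \<phi> c\<close> other than \<open>c\<close> is \<open>\<phi> i\<close> for some \<open>i \<in> A\<close>, which is clear with \<open>i < c\<close> unless
  \<open>c = 1\<close>, where \<open>0 = \<phi> 2\<close> and one uses that \<open>2\<close> occurs on the window as well.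
\<close>

lemma mex_eqI:
  assumes "n \<notin> S" and "\<And>m. m < n \<Longrightarrow> m \<in> S"
  shows "mex S = n"
  unfolding mex_def using assms by (intro Least_equality) (auto simp flip: not_less)

lemma mex_notin:
  assumes "finite S"
  shows "mex S \<notin> S"
  unfolding mex_def using ex_new_if_finite[OF infinite_UNIV_nat assms] by (rule LeastI_ex)

lemma less_mex_imp_mem: "m < mex S \<Longrightarrow> m \<in> S"
  unfolding mex_def using not_less_Least by blast

text \<open>The ceiling bound on \<open>v\<close> is the strict inequality
  \<open>2 * v < t + 2\<close>, which amounts to \<open>t - v \<ge> t div 2\<close>.\<close>

lemma stone_moves_eq: "stone_moves (t, p) = (\<lambda>s. (s, p)) ` {t div 2..<t}"
proof -
  have bound: "int v \<le> \<lceil>real t / 2\<rceil> \<longleftrightarrow> 2 * v < t + 2" for v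
    by (simp add: le_ceiling_iff) linarith
  have "{t - v | v. v > 0 \<and> 2 * v < t + 2} = {t div 2..<t}"
  proof (intro equalityI subsetI)
    fix s assume "s \<in> {t div 2..<t}"
    then have "s = t - (t - s)" "t - s > 0" "2 * (t - s) < t + 2"
      by auto
    then show "s \<in> {t - v | v. v > 0 \<and> 2 * v < t + 2}"
      by blast
  qed auto
  then show ?thesis
    unfolding stone_moves_def by (auto simp: bound)
qed

lemma grundy_no_pass: "grundy (t, 0) = mex ((\<lambda>s. grundy (s, 0)) ` {t div 2..<t})"
  by (subst grundy.simps) (simp add: moves_def stone_moves_eq image_image)

lemma grundy_pass:
  assumes "t > 0"
  shows "grundy (t, 1) = mex (insert (grundy (t, 0)) ((\<lambda>s. grundy (s, 1)) ` {t div 2..<t}))"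
  using assms by (subst grundy.simps) (simp add: moves_def stone_moves_eq image_image)

lemma grundy_zero: "grundy (0, p) = 0"
  by (subst grundy.simps) (simp add: moves_def stone_moves_eq mex_def)

lemma grundy_odd_of_window:
  assumes "(\<lambda>s. grundy (s, 0)) ` {k..2 * k} = {..k}"
  shows "grundy (2 * k + 1, 0) = k + 1"
proof -
  have "{(2 * k + 1) div 2..<2 * k + 1} = {k..2 * k}"
    by auto
  then show ?thesis
    unfolding grundy_no_pass[of "2 * k + 1"] using assms by (auto intro: mex_eqI)
qed

lemma window_even_of_window:
  assumes "(\<lambda>s. grundy (s, 0)) ` {k..2 * k} = {..k}"
  shows "(\<lambda>s. grundy (s, 0)) ` {k + 1..<2 * k + 2} = {..k + 1} - {grundy (k, 0)}"
proof -
  let ?g = "\<lambda>s. grundy (s, 0)"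
  \<comment> \<open>There are \<open>k + 1\<close> positions and \<open>k + 1\<close> values, so
    dropping position \<open>k\<close> removes its value entirely.\<close>
  have inj: "inj_on ?g {k..2 * k}"
    by (rule eq_card_imp_inj_on) (simp_all add: assms)
  have "?g k \<le> k"
    using assms by auto
  have split: "{k + 1..<2 * k + 2} = insert (2 * k + 1) ({k..2 * k} - {k})"
    by auto
  have "?g ` ({k..2 * k} - {k}) = {..k} - {?g k}"
    using inj assms by (subst inj_on_image_set_diff[OF inj]) auto
  then have "?g ` {k + 1..<2 * k + 2} = insert (k + 1) ({..k} - {?g k})"
    by (simp only: split image_insert grundy_odd_of_window[OF assms])
  also have "\<dots> = {..k + 1} - {?g k}"
    using \<open>?g k \<le> k\<close> by auto
  finally show ?thesis .
qed

lemma grundy_even_of_window: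
  assumes "(\<lambda>s. grundy (s, 0)) ` {k..2 * k} = {..k}"
  shows "grundy (2 * k + 2, 0) = grundy (k, 0)"
proof -
  have "grundy (k, 0) \<le> k"
    using assms by auto
  then show ?thesis
    unfolding grundy_no_pass[of "2 * k + 2"]
    using window_even_of_window[OF assms] by (auto intro: mex_eqI)
qed

lemma grundy_window: "(\<lambda>s. grundy (s, 0)) ` {k..2 * k} = {..k}"
proof (induction k)
  case 0
  show ?case
    by (simp add: grundy_zero)
next
  case (Suc k)
  let ?g = "\<lambda>s. grundy (s, 0)"
  have "?g k \<le> k"
    using Suc.IH by auto
  have "{Suc k..2 * Suc k} = insert (2 * k + 2) {k + 1..<2 * k + 2}"
    by auto
  then have "?g ` {Suc k..2 * Suc k} = insert (?g k) ({..k + 1} - {?g k})"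
    by (simp only: image_insert grundy_even_of_window[OF Suc.IH]
        window_even_of_window[OF Suc.IH])
  also have "\<dots> = {..Suc k}"
    using \<open>?g k \<le> k\<close> by auto
  finally show ?case .
qed

text \<open>An odd pile \<open>2 * k + 1\<close> has value \<open>k + 1\<close>, so value 1 forces a
  single stone. For \<open>2 * k + 2\<close> the value 1 is that of \<open>k\<close>, whence
  \<open>k \<ge> 1\<close>, and the window attains everything up to \<open>k + 1\<close> except
  1.\<close>

lemma two_in_window_if_grundy_eq_one:
  assumes "t > 1" and "grundy (t, 0) = 1"
  shows "2 \<in> (\<lambda>s. grundy (s, 0)) ` {t div 2..<t}"
proof (cases "odd t")
  case True
  then obtain k where "t = 2 * k + 1"
    by (elim oddE)
  then show ?thesis
    using assms grundy_odd_of_window[OF grundy_window, of k] by simp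
next
  case False
  with \<open>t > 1\<close> have "t = 2 * (t div 2 - 1) + 2"
    by presburger
  then obtain k where t: "t = 2 * k + 2" ..
  have one: "grundy (k, 0) = 1"
    using assms(2) grundy_even_of_window[OF grundy_window, of k] t by simp
  moreover have "grundy (k, 0) \<le> k"
    using grundy_window[of k] by auto
  ultimately have "2 \<in> {..k + 1} - {grundy (k, 0)}"
    by simp
  moreover have "{t div 2..<t} = {k + 1..<2 * k + 2}"
    using t by simp
  ultimately show ?thesis
    using window_even_of_window[OF grundy_window, of k] by simp
qed

text \<open>A permutation: the 3-cycle sending 0 to 1, 1 to 2 and 2 to 0, and the swaps of
  \<open>2 * m - 1\<close> with \<open>2 * m\<close> for \<open>m \<ge> 2\<close>.\<close>

definition pass_value :: "nat \<Rightarrow> nat" where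
  "pass_value n = (if n = 0 then 1 else if n = 2 then 0 else if odd n then n + 1 else n - 1)"

lemma inj_pass_value: "inj pass_value"
proof (rule injI)
  fix x y assume "pass_value x = pass_value y"
  then show "x = y"
    unfolding pass_value_def by (simp split: if_splits) presburger+
qed

lemma pass_value_neq: "pass_value n \<noteq> n"
  by (auto simp: pass_value_def)

lemma less_pass_value_cases:
  assumes "j < pass_value c"
  obtains "j = c" | i where "i < c" "j = pass_value i" | "c = 1" "j = pass_value 2"
proof -
  \<comment> \<open>The cases are sorted by the preimage of \<open>j\<close>: 2 for 0, 0 for 1,
    otherwise \<open>j + 1\<close> or \<open>j - 1\<close> by parity. For odd
    \<open>j \<ge> 2\<close>, \<open>c = j + 1\<close> cannot occur, since then
    \<open>pass_value c = j\<close>.\<close>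
  have "j = c \<or> (c = 1 \<and> j = 0) \<or> (c \<ge> 3 \<and> j = 0) \<or> (c \<ge> 3 \<and> j = 1)
      \<or> (j \<ge> 2 \<and> odd j \<and> j + 1 < c) \<or> (j \<ge> 2 \<and> even j \<and> j < c)"
    using assms unfolding pass_value_def by presburger
  then consider "j = c" | "c = 1" "j = 0" | "c \<ge> 3" "j = 0" | "c \<ge> 3" "j = 1"
    | "j \<ge> 2" "odd j" "j + 1 < c" | "j \<ge> 2" "even j" "j < c"
    by blast
  then show thesis
  proof cases
    case 3
    then show thesis using that(2)[of 2] by (simp add: pass_value_def)
  next
    case 4
    then show thesis using that(2)[of 0] by (simp add: pass_value_def)
  next
    case 5
    then show thesis using that(2)[of "j + 1"] by (simp add: pass_value_def)
  next
    case 6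
    then have "j - 1 < c" "j = pass_value (j - 1)"
      unfolding pass_value_def by presburger+
    then show thesis by (rule that(2))
  qed (use that in \<open>auto simp: pass_value_def\<close>)
qed

lemma mex_insert_pass_value:
  assumes "finite A" and "mex A = 1 \<Longrightarrow> 2 \<in> A"
  shows "mex (insert (mex A) (pass_value ` A)) = pass_value (mex A)"
proof (rule mex_eqI)
  show "pass_value (mex A) \<notin> insert (mex A) (pass_value ` A)"
    using mex_notin[OF assms(1)] by (simp add: pass_value_neq inj_image_mem_iff[OF inj_pass_value])
next
  fix j assume "j < pass_value (mex A)"
  then show "j \<in> insert (mex A) (pass_value ` A)"
    by (cases rule: less_pass_value_cases) (use assms(2) less_mex_imp_mem[of _ A] in auto)
qed

lemma grundy_pass_eq:
  assumes "t > 0"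
  shows "grundy (t, 1) = pass_value (grundy (t, 0))"
  using assms
proof (induction t rule: less_induct)
  case (less t)
  show ?case
  \<comment> \<open>The window of one stone contains the empty pile, where
    \<open>grundy (0, 1)\<close> is 0 and not \<open>pass_value 0\<close>. For larger
    \<open>t\<close> the window starts at \<open>t div 2 > 0\<close>.\<close>
  proof (cases "t = 1")
    case True
    have "mex {0} = 1" "mex {0, 1} = 2"
      by (auto intro!: mex_eqI)
    moreover have "{1 div 2..<1} = {0::nat}"
      by auto
    ultimately show ?thesis
      using True grundy_no_pass[of 1] grundy_pass[of 1]
      by (simp add: grundy_zero pass_value_def insert_commute)
  next
    case False
    let ?A = "(\<lambda>s. grundy (s, 0)) ` {t div 2..<t}"
    have "t > 1"
      using less.prems False by simp
    then have "grundy (s, 1) = pass_value (grundy (s, 0))" if "s \<in> {t div 2..<t}" for s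
      using that less.IH by auto
    then have "(\<lambda>s. grundy (s, 1)) ` {t div 2..<t} = pass_value ` ?A"
      unfolding image_image by (rule image_cong[OF refl])
    then have "grundy (t, 1) = mex (insert (mex ?A) (pass_value ` ?A))"
      using grundy_pass[OF less.prems] grundy_no_pass[of t] by simp
    also have "\<dots> = pass_value (mex ?A)"
      using two_in_window_if_grundy_eq_one[OF \<open>t > 1\<close>]
      by (intro mex_insert_pass_value) (simp_all flip: grundy_no_pass)
    finally show ?thesis
      by (simp flip: grundy_no_pass)
  qed
qed

theorem theorem3:
  shows "(grundy (0, 0) = 0 \<and> grundy (0, 1) = 0) \<and>
    (\<forall>u::nat. u > 0 \<longrightarrow> grundy (u, 0) = 0 \<longrightarrow> grundy (u, 1) = 1) \<and>
    (\<forall>u::nat. u > 0 \<longrightarrow> grundy (u, 0) = 2 \<longrightarrow> grundy (u, 1) = 0) \<and>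
    (\<forall>u m::nat. u > 0 \<longrightarrow> m > 1 \<longrightarrow> grundy (u, 0) = 2 * m \<longrightarrow> grundy (u, 1) = 2 * m - 1) \<and>
    (\<forall>u m::nat. u > 0 \<longrightarrow> m > 0 \<longrightarrow> grundy (u, 0) = 2 * m - 1 \<longrightarrow> grundy (u, 1) = 2 * m)"
  by (auto simp: grundy_zero grundy_pass_eq[unfolded One_nat_def] pass_value_def) presburger

end
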